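(* Let $X$ be a uniformly convex and uniformly smooth real Banach space whose moduli of smoothness and convexity are of power type. Let $R>0$, let $A\subset X$ be a proximally smooth set with constant $R$, and let $x_0,x_1\in A$ with $\frac{\|x_0-x_1\|}{R}<2$. Then there is a rectifiable curve $\gamma$ in $A$ with endpoints $x_0$ and $x_1$.
   Context: Modulus of smoothness: $\varrho_X(\tau)=\sup\left\{\frac{\|x+y\|+\|x-y\|}{2}-1:\ \|x\|=1,\ \|y\|=\tau\right\}$, $\tau\ge 0$; it is of power type if for some $s\in(1,2]$ and some constant $C_{sm}$ one has $\varrho_X(\tau)\le C_{sm}\tau^s$ for all $\tau\ge0$. $X$ is uniformly smooth if $\varrho_X(\tau)/\tau\to0$ as $\tau\to0$. Modulus of convexity: $\delta_X(\varepsilon)=\inf\left\{1-\frac{\|x+y\|}{2}:\ \|x\|\le1,\ \|y\|\le1,\ \|x-y\|\ge\varepsilon\right\}$, $\varepsilon\in[0,2]$; it is of power type if for some $q>0$ and some constant $C_{cv}>0$ one has $\delta_X(\varepsilon)\ge C_{cv}\varepsilon^q$ for all $\varepsilon\in[0,2)$ (the exponents $s$ and $q$ need not coincide). $X$ is uniformly convex if $\delta_X(\varepsilon)>0$ for all $\varepsilon>0$. With $\mathrm{dist}(x,A)=\inf_{a\in A}\|x-a\|$, a set $A\subset X$ is proximally smooth with constant $R>0$ if it is closed and the function $x\mapsto\mathrm{dist}(x,A)$ is continuously differentiable on the open set $\{x\in X:0<\mathrm{dist}(x,A)<R\}$. A rectifiable curve in $A$ with endpoints $x_0,x_1$ is a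 continuous map $f:[0,1]\to A$ of finite length (bounded variation) with $f(0)=x_0$, $f(1)=x_1$. *)

theory Defs
  imports "HOL-Analysis.Analysis"
begin

(* Sup and Inf are taken in the reals.  For a nonzero space both sets below are nonempty and
   bounded (for 0 <= tau and 0 <= epsilon <= 2), so these are the usual moduli; on the zero
   space, where the moduli are not meaningful, the values are unspecified. *)

definition smoothness_modulus :: "'a::real_normed_vector itself \<Rightarrow> real \<Rightarrow> real" where
  "smoothness_modulus _ \<tau> =
     Sup {(norm (x + y) + norm (x - y)) / 2 - 1 | x y :: 'a. norm x = 1 \<and> norm y = \<tau>}"

definition convexity_modulus :: "'a::real_normed_vector itself \<Rightarrow> real \<Rightarrow> real" where
  "convexity_modulus _ \<epsilon> =
     Inf {1 - norm (x + y) / 2 | x y :: 'a. norm x \<le> 1 \<and> norm y \<le> 1 \<and> norm (x - y) \<ge> \<epsilon>}"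

definition uniformly_smooth :: "'a::real_normed_vector itself \<Rightarrow> bool" where
  "uniformly_smooth X \<longleftrightarrow> ((\<lambda>\<tau>. smoothness_modulus X \<tau> / \<tau>) \<longlongrightarrow> 0) (at_right 0)"

(* The modulus of convexity has domain [0,2], hence the upper bound on epsilon. *)
definition uniformly_convex :: "'a::real_normed_vector itself \<Rightarrow> bool" where
  "uniformly_convex X \<longleftrightarrow> (\<forall>\<epsilon>. 0 < \<epsilon> \<and> \<epsilon> \<le> 2 \<longrightarrow> convexity_modulus X \<epsilon> > 0)"

definition smoothness_of_power_type :: "'a::real_normed_vector itself \<Rightarrow> bool" where
  "smoothness_of_power_type X \<longleftrightarrow>
     (\<exists>s C. 1 < s \<and> s \<le> 2 \<and> (\<forall>\<tau>\<ge>0. smoothness_modulus X \<tau> \<le> C * \<tau> powr s))"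

definition convexity_of_power_type :: "'a::real_normed_vector itself \<Rightarrow> bool" where
  "convexity_of_power_type X \<longleftrightarrow>
     (\<exists>q C. q > 0 \<and> C > 0 \<and> (\<forall>\<epsilon>. 0 \<le> \<epsilon> \<and> \<epsilon> < 2 \<longrightarrow> convexity_modulus X \<epsilon> \<ge> C * \<epsilon> powr q))"

(* Frechet differentiability, with derivative continuous in the dual norm. *)
definition continuously_differentiable_on :: "('a::real_normed_vector \<Rightarrow> real) \<Rightarrow> 'a set \<Rightarrow> bool" where
  "continuously_differentiable_on f U \<longleftrightarrow>
     (\<exists>D :: 'a \<Rightarrow> 'a \<Rightarrow>\<^sub>L real.
        (\<forall>x\<in>U. (f has_derivative blinfun_apply (D x)) (at x)) \<and> continuous_on U D)"

(* infdist x {} = 0 in the library, so the empty set counts as proximally smooth. *)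
definition proximally_smooth :: "real \<Rightarrow> 'a::real_normed_vector set \<Rightarrow> bool" where
  "proximally_smooth R A \<longleftrightarrow> R > 0 \<and> closed A \<and>
     continuously_differentiable_on (\<lambda>x. infdist x A) {x. 0 < infdist x A \<and> infdist x A < R}"

definition inscribed_lengths :: "(real \<Rightarrow> 'a::real_normed_vector) \<Rightarrow> real set" where
  "inscribed_lengths f =
     {\<Sum>i<n. norm (f (t (Suc i)) - f (t i)) | (n :: nat) (t :: nat \<Rightarrow> real).
        t 0 = 0 \<and> t n = 1 \<and> (\<forall>i<n. t i \<le> t (Suc i))}"

definition rectifiable_curve_in ::
    "'a::real_normed_vector set \<Rightarrow> 'a \<Rightarrow> 'a \<Rightarrow> (real \<Rightarrow> 'a) \<Rightarrow> bool" where
  "rectifiable_curve_in A x\<^sub>0 x\<^sub>1 f \<longleftrightarrow>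
     path f \<and> path_image f \<subseteq> A \<and> bdd_above (inscribed_lengths f) \<and>
     pathstart f = x\<^sub>0 \<and> pathfinish f = x\<^sub>1"

end

theory Submission
  imports Defs
begin

text \<open>Where the distance function \<open>d\<close> of \<open>A\<close> is differentiable, its derivative at \<open>x\<close>
  sends \<open>x - a\<close> to nearly \<open>norm (x - a)\<close> for nearly nearest points \<open>a \<in> A\<close>; uniform convexity turns this
  into existence and continuity of the metric projection on the tube \<open>d < R\<close>. As the derivative has
  norm 1, Ekeland's principle gives, for \<open>d z + s < R\<close>, points \<open>y\<close> at distance \<open>s\<close> from \<open>z\<close> with
  \<open>d y\<close> arbitrarily close to \<open>d z + s\<close>. If \<open>z\<close> is the midpoint of \<open>a, b \<in> A\<close>, both endpoints are
  at least that far from \<open>y\<close>, and smoothness of power type \<open>p > 1\<close> forces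
  \<open>d z \<le> K * norm (a - b) powr p\<close>. Projecting midpoints and iterating dyadically therefore joins
  close points of \<open>A\<close> by Lipschitz curves. The segment from \<open>x\<^sub>0\<close> to \<open>x\<^sub>1\<close> lies in the tube, its
  projection is a connected subset of \<open>A\<close>, and being joined by a Lipschitz curve is an equivalence
  relation with open classes on it.\<close>

section \<open>Uniform convexity and smoothness\<close>

lemma uniformly_convexE:
  assumes "uniformly_convex TYPE('a::real_normed_vector)" and "e > 0"
  obtains d where "d > 0"
    "\<And>x y::'a. norm x \<le> 1 \<Longrightarrow> norm y \<le> 1 \<Longrightarrow> norm (x + y) > 2 - d \<Longrightarrow> norm (x - y) < e"
proof -
  \<comment> \<open>The modulus carries information only up to \<open>2\<close>. Capping
    \<open>e\<close> there is harmless, since \<open>norm (x - y) \<ge> e\<close> implies the capped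
    inequality.\<close>
  define m where "m = convexity_modulus TYPE('a) (min e 2)"
  have "m > 0"
    using assms by (simp add: uniformly_convex_def m_def)
  have "norm (x - y) < e"
    if "norm x \<le> 1" "norm y \<le> 1" "norm (x + y) > 2 - 2 * m" for x y :: 'a
  proof (rule ccontr)
    assume "\<not> norm (x - y) < e"
    let ?S = "{1 - norm (x + y) / 2 | x y :: 'a. norm x \<le> 1 \<and> norm y \<le> 1 \<and> norm (x - y) \<ge> min e 2}"
    have "bdd_below ?S"
    proof (rule bdd_belowI[where m = 0])
      fix v assume "v \<in> ?S"
      then obtain x y :: 'a where "v = 1 - norm (x + y) / 2" "norm x \<le> 1" "norm y \<le> 1" by blast
      then show "0 \<le> v" using norm_triangle_ineq[of x y] by simp
    qed
    moreover have "1 - norm (x + y) / 2 \<in> ?S"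
      using that \<open>\<not> norm (x - y) < e\<close> by fastforce
    ultimately have "m \<le> 1 - norm (x + y) / 2"
      unfolding m_def convexity_modulus_def by (intro cInf_lower)
    then show False using that by simp
  qed
  with \<open>m > 0\<close> show ?thesis by (intro that[of "2 * m"]) auto
qed

text \<open>Rescaling by \<open>r + d\<close> gives the form fit for almost nearest points: with
  \<open>r\<close> the distance of a point from a set, differences to such points have norm at most
  \<open>r + d\<close>.\<close>

lemma uniformly_convex_scaledE:
  assumes "uniformly_convex TYPE('a::real_normed_vector)" and "e > 0" and "r > 0"
  obtains d where "d > 0"
    "\<And>x y::'a. norm x \<le> r + d \<Longrightarrow> norm y \<le> r + d \<Longrightarrow> norm (x + y) \<ge> 2 * (r - d)
      \<Longrightarrow> norm (x - y) < e"
proof -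
  obtain c where c: "c > 0" "\<And>x y::'a. norm x \<le> 1 \<Longrightarrow> norm y \<le> 1 \<Longrightarrow> norm (x + y) > 2 - c
      \<Longrightarrow> norm (x - y) < e / (2 * r)"
    using uniformly_convexE[OF assms(1), of "e / (2 * r)"] assms by auto
  \<comment> \<open>\<open>4 * d \<le> c * r\<close> makes \<open>2 * (r - d)\<close> exceed
    \<open>(2 - c) * (r + d)\<close>, and \<open>d \<le> r\<close> keeps the scaling factor at most
    \<open>2 * r\<close>.\<close>
  define d where "d = min r (c * r / 4)"
  have d: "d > 0" "d \<le> r" "4 * d \<le> c * r" using c assms by (auto simp: d_def)
  have "norm (x - y) < e"
    if xy: "norm x \<le> r + d" "norm y \<le> r + d" "norm (x + y) \<ge> 2 * (r - d)" for x y :: 'a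
  proof -
    define k where "k = r + d"
    have k: "k > 0" "k \<le> 2 * r" using d assms by (auto simp: k_def)
    have "c * r < c * k" using c d by (simp add: k_def)
    then have "(2 - c) * k < norm (x + y)"
      using xy(3) d(3) unfolding k_def by (simp add: algebra_simps)
    then have "2 - c < norm (x /\<^sub>R k + y /\<^sub>R k)"
      using k by (simp flip: scaleR_add_right add: pos_less_divide_eq divide_inverse_commute[symmetric])
    moreover have "norm (x /\<^sub>R k) \<le> 1" "norm (y /\<^sub>R k) \<le> 1"
      using xy(1,2) k by (simp_all add: divide_inverse_commute[symmetric] flip: k_def)
    ultimately have "norm (x /\<^sub>R k - y /\<^sub>R k) < e / (2 * r)"
      by (intro c(2))
    then have "norm (x - y) < e / (2 * r) * k"
      using k by (simp flip: scaleR_diff_right add: pos_divide_less_eq divide_inverse_commute[symmetric])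
    also have "\<dots> \<le> e / (2 * r) * (2 * r)"
      using k assms by (intro mult_left_mono) auto
    finally show ?thesis using assms by simp
  qed
  with d show ?thesis by (intro that[of d]) auto
qed

text \<open>Dividing both vectors by \<open>norm x\<close> reduces to unit \<open>x\<close>; the set
  of values is bounded above, so its \<open>Sup\<close> is a genuine bound.\<close>

lemma smoothness_modulus_upper:
  fixes x y :: "'a::real_normed_vector"
  assumes "x \<noteq> 0"
  shows "norm (x + y) + norm (x - y) \<le> 2 * norm x * (1 + smoothness_modulus TYPE('a) (norm y / norm x))"
proof -
  define n where "n = norm x"
  have n: "n > 0" using assms by (simp add: n_def)
  let ?S = "\<lambda>t. {(norm (x + y) + norm (x - y)) / 2 - 1 | x y :: 'a. norm x = 1 \<and> norm y = t}"
  have "bdd_above (?S t)" for t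
  proof (rule bdd_aboveI[where M = t])
    fix v assume "v \<in> ?S t"
    then obtain x y :: 'a where "v = (norm (x + y) + norm (x - y)) / 2 - 1" "norm x = 1" "norm y = t"
      by blast
    then show "v \<le> t"
      using norm_triangle_ineq[of x y] norm_triangle_ineq4[of x y] by (simp add: field_simps)
  qed
  moreover have "(norm (x /\<^sub>R n + y /\<^sub>R n) + norm (x /\<^sub>R n - y /\<^sub>R n)) / 2 - 1 \<in> ?S (norm y / n)"
  proof -
    have "norm (x /\<^sub>R n) = 1" "norm (y /\<^sub>R n) = norm y / n"
      using n by (simp_all add: n_def divide_inverse_commute)
    then show ?thesis by blast
  qed
  ultimately have "(norm (x /\<^sub>R n + y /\<^sub>R n) + norm (x /\<^sub>R n - y /\<^sub>R n)) / 2 - 1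
      \<le> smoothness_modulus TYPE('a) (norm y / n)"
    unfolding smoothness_modulus_def by (intro cSup_upper) auto
  then show ?thesis
    using n unfolding n_def[symmetric]
    by (simp flip: scaleR_add_right scaleR_diff_right add: divide_inverse_commute[symmetric])
      (simp add: field_simps)
qed

section \<open>A variational principle\<close>

text \<open>Ekeland's principle for maxima: \<open>c * dist y z \<le> f z - f y\<close> is a partial
  order on \<open>S\<close>, and a sequence of greedy steps converges to an element with nothing
  else above it.\<close>

lemma ekeland_maximal:
  fixes S :: "'a::metric_space set" and f :: "'a \<Rightarrow> real"
  assumes "complete S" and cont: "continuous_on S f" and bdd: "bdd_above (f ` S)"
    and "c > 0" and "x \<in> S"
  obtains y where "y \<in> S" "c * dist x y \<le> f y - f x"
    "\<And>z. z \<in> S \<Longrightarrow> c * dist y z \<le> f z - f y \<Longrightarrow> z = y"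
proof -
  define T where "T y = {z \<in> S. c * dist y z \<le> f z - f y}" for y
  have T_refl: "y \<in> T y" if "y \<in> S" for y using that by (simp add: T_def)
  have T_trans: "z \<in> T x" if "y \<in> T x" "z \<in> T y" for x y z
  proof -
    have "c * dist x z \<le> c * (dist x y + dist y z)"
      using \<open>c > 0\<close> dist_triangle by simp
    then show ?thesis using that by (simp add: T_def algebra_simps)
  qed
  have bddT: "bdd_above (f ` T y)" for y
    by (rule bdd_above_mono[OF bdd]) (auto simp: T_def)
  \<comment> \<open>A greedy step realizes at least half of the gain still available above
    \<open>y\<close>.\<close>
  have step: "\<exists>z\<in>T y. Sup (f ` T y) \<le> 2 * f z - f y" if y: "y \<in> S" for y
  proof (cases "Sup (f ` T y) = f y")
    case True
    then show ?thesis using T_refl[OF y] by force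
  next
    case False
    have "f y \<le> Sup (f ` T y)"
      using T_refl[OF y] bddT by (intro cSup_upper) auto
    with False have "(f y + Sup (f ` T y)) / 2 < Sup (f ` T y)" by simp
    then obtain z where "z \<in> T y" "(f y + Sup (f ` T y)) / 2 < f z"
      using less_cSupD[of "f ` T y"] T_refl[OF y] by blast
    then show ?thesis by (intro bexI[of _ z]) auto
  qed
  then obtain g where g: "\<And>y. y \<in> S \<Longrightarrow> g y \<in> T y \<and> Sup (f ` T y) \<le> 2 * f (g y) - f y"
    by metis
  define u where "u n = (g ^^ n) x" for n
  have uS: "u n \<in> S" for n
    by (induction n) (use g \<open>x \<in> S\<close> in \<open>auto simp: u_def T_def\<close>)
  have uSuc: "u (Suc n) = g (u n)" for n by (simp add: u_def)
  have uT: "u m \<in> T (u n)" if "n \<le> m" for n m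
    using that
  proof (induction rule: dec_induct)
    case (step k)
    then show ?case using T_trans g[OF uS] uSuc by metis
  qed (simp add: T_refl uS)
  \<comment> \<open>Increments of \<open>f\<close> along \<open>u\<close> dominate \<open>c\<close>
    times the distances, so convergence of the values makes \<open>u\<close> Cauchy.\<close>
  have "incseq (\<lambda>n. f (u n))"
    using uT \<open>c > 0\<close> unfolding incseq_def T_def
    by (smt (verit) mem_Collect_eq mult_nonneg_nonneg zero_le_dist)
  moreover have "bdd_above (range (\<lambda>n. f (u n)))"
    by (rule bdd_above_mono[OF bdd]) (use uS in auto)
  ultimately obtain L where L: "(\<lambda>n. f (u n)) \<longlonglongrightarrow> L" "\<And>n. f (u n) \<le> L"
    using LIMSEQ_incseq_SUP incseq_le by metis
  have "Cauchy u"
  proof (rule metric_CauchyI)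
    fix e :: real assume "e > 0"
    then have "c * e / 2 > 0" using \<open>c > 0\<close> by simp
    then obtain N where N: "\<And>n. n \<ge> N \<Longrightarrow> \<bar>f (u n) - L\<bar> < c * e / 2"
      using LIMSEQ_D[OF L(1)] by (metis real_norm_def)
    have near: "dist (u N) (u n) < e / 2" if "n \<ge> N" for n
    proof -
      have "c * dist (u N) (u n) \<le> f (u n) - f (u N)" using uT[OF that] by (simp add: T_def)
      also have "\<dots> < c * (e / 2)" using N[of N] L(2)[of n] unfolding abs_less_iff by simp
      finally show ?thesis using \<open>c > 0\<close> by simp
    qed
    have "dist (u m) (u n) < e" if "m \<ge> N" "n \<ge> N" for m n
      using near[OF that(1)] near[OF that(2)] dist_triangle_half_r by blast
    then show "\<exists>M. \<forall>m\<ge>M. \<forall>n\<ge>M. dist (u m) (u n) < e" by blast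
  qed
  then obtain y where y: "y \<in> S" "u \<longlonglongrightarrow> y"
    using \<open>complete S\<close> uS unfolding complete_def by blast
  have fy: "(\<lambda>n. f (u n)) \<longlonglongrightarrow> f y"
    using continuous_on_tendsto_compose[OF cont y(2,1)] uS by simp
  have yT: "y \<in> T (u n)" for n
  proof -
    have "c * dist (u n) y \<le> f y - f (u n)"
    proof (rule LIMSEQ_le)
      show "(\<lambda>m. c * dist (u n) (u m)) \<longlonglongrightarrow> c * dist (u n) y"
        by (intro tendsto_intros y)
      show "(\<lambda>m. f (u m) - f (u n)) \<longlonglongrightarrow> f y - f (u n)"
        by (intro tendsto_intros fy)
      show "\<exists>N. \<forall>m\<ge>N. c * dist (u n) (u m) \<le> f (u m) - f (u n)"
        using uT by (auto simp: T_def)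
    qed
    with y show ?thesis by (simp add: T_def)
  qed
  show ?thesis
  proof (rule that[OF y(1)])
    show "c * dist x y \<le> f y - f x" using yT[of 0] by (simp add: u_def T_def)
  next
    fix z assume z: "z \<in> S" "c * dist y z \<le> f z - f y"
    then have "z \<in> T (u n)" for n using yT T_trans by (auto simp: T_def)
    \<comment> \<open>The half-gain rule bounds \<open>f z\<close> by an expression that tends to
      \<open>f y\<close>.\<close>
    then have "f z \<le> 2 * f (u (Suc n)) - f (u n)" for n
      using g[OF uS] uSuc cSup_upper[OF imageI bddT] by (metis order_trans)
    moreover have "(\<lambda>n. 2 * f (u (Suc n)) - f (u n)) \<longlonglongrightarrow> 2 * f y - f y"
      by (intro tendsto_intros fy LIMSEQ_Suc)
    ultimately have "f z \<le> f y"
      using LIMSEQ_le_const by fastforce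
    with z \<open>c > 0\<close> show "z = y"
      by (smt (verit) dist_eq_0_iff mult_pos_pos zero_le_dist)
  qed
qed


section \<open>Lipschitz curves\<close>

text \<open>A Lipschitz bound gives continuity and finite length at once and, with \<open>L\<close>
  left existential, survives reversal and concatenation.\<close>

definition lipschitz_joined :: "'a::metric_space set \<Rightarrow> 'a \<Rightarrow> 'a \<Rightarrow> bool" where
  "lipschitz_joined A a b \<longleftrightarrow>
     (\<exists>f L. L-lipschitz_on {0..1::real} f \<and> f ` {0..1} \<subseteq> A \<and> f 0 = a \<and> f 1 = b)"

lemma lipschitz_joined_sym:
  assumes "lipschitz_joined A a b"
  shows "lipschitz_joined A b a"
proof -
  obtain f :: "real \<Rightarrow> 'a" and L where f: "L-lipschitz_on {0..1} f" "f ` {0..1} \<subseteq> A" "f 0 = a" "f 1 = b"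
    using assms unfolding lipschitz_joined_def by blast
  have "L-lipschitz_on {0..1} (\<lambda>t. f (1 - t))"
  proof (rule lipschitz_onI)
    fix x y :: real assume "x \<in> {0..1}" "y \<in> {0..1}"
    then show "dist (f (1 - x)) (f (1 - y)) \<le> L * dist x y"
      using lipschitz_onD[OF f(1), of "1 - x" "1 - y"] by (simp add: dist_real_def abs_minus_commute)
  qed (rule lipschitz_on_nonneg[OF f(1)])
  with f(2-4) show ?thesis
    unfolding lipschitz_joined_def
    by (intro exI[of _ "\<lambda>t. f (1 - t)"] exI[of _ L]) (auto simp: image_subset_iff)
qed

lemma lipschitz_joined_trans:
  assumes "lipschitz_joined A a b" "lipschitz_joined A b c"
  shows "lipschitz_joined A a c"
proof -
  obtain f :: "real \<Rightarrow> 'a" and L where f: "L-lipschitz_on {0..1} f" "f ` {0..1} \<subseteq> A" "f 0 = a" "f 1 = b"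
    using assms(1) unfolding lipschitz_joined_def by blast
  obtain g :: "real \<Rightarrow> 'a" and M where g: "M-lipschitz_on {0..1} g" "g ` {0..1} \<subseteq> A" "g 0 = b" "g 1 = c"
    using assms(2) unfolding lipschitz_joined_def by blast
  define N where "N = 2 * max L M"
  have N: "0 \<le> N" using lipschitz_on_nonneg[OF f(1)] by (simp add: N_def)
  have 1: "N-lipschitz_on {0..1/2} (\<lambda>t. f (2 * t))"
  proof (rule lipschitz_onI[OF _ N])
    fix x y :: real assume "x \<in> {0..1/2}" "y \<in> {0..1/2}"
    then have "dist (f (2 * x)) (f (2 * y)) \<le> L * dist (2 * x) (2 * y)"
      using lipschitz_onD[OF f(1), of "2 * x" "2 * y"] by simp
    also have "\<dots> \<le> max L M * dist (2 * x) (2 * y)" by (intro mult_right_mono) auto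
    finally show "dist (f (2 * x)) (f (2 * y)) \<le> N * dist x y" by (simp add: N_def dist_mult_left)
  qed
  have 2: "N-lipschitz_on {1/2..1} (\<lambda>t. g (2 * t - 1))"
  proof (rule lipschitz_onI[OF _ N])
    fix x y :: real assume "x \<in> {1/2..1}" "y \<in> {1/2..1}"
    then have "dist (g (2 * x - 1)) (g (2 * y - 1)) \<le> M * dist (2 * x - 1) (2 * y - 1)"
      using lipschitz_onD[OF g(1), of "2 * x - 1" "2 * y - 1"] by simp
    also have "\<dots> \<le> max L M * dist (2 * x - 1) (2 * y - 1)" by (intro mult_right_mono) auto
    also have "dist (2 * x - 1) (2 * y - 1) = dist (2 * x) (2 * y)" by (simp add: dist_norm)
    finally show "dist (g (2 * x - 1)) (g (2 * y - 1)) \<le> N * dist x y"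
      by (simp add: N_def dist_mult_left)
  qed
  have "N-lipschitz_on {0..1} (\<lambda>t. if t \<le> 1/2 then f (2 * t) else g (2 * t - 1))"
    using lipschitz_on_concat[OF 1 2] f(4) g(3) by simp
  with f(2,3) g(2,4) show ?thesis
    unfolding lipschitz_joined_def
    by (intro exI[of _ "\<lambda>t. if t \<le> 1/2 then f (2 * t) else g (2 * t - 1)"] exI[of _ N])
      (auto simp: image_subset_iff)
qed

text \<open>The Lipschitz bounds on the pieces of a partition telescope to
  \<open>L * (t n - t 0) = L\<close>.\<close>

lemma lipschitz_imp_bdd_above_inscribed_lengths:
  assumes "L-lipschitz_on {0..1} f"
  shows "bdd_above (inscribed_lengths f)"
proof (rule bdd_aboveI[where M = L])
  fix v assume "v \<in> inscribed_lengths f"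
  then obtain n :: nat and t :: "nat \<Rightarrow> real"
    where v: "v = (\<Sum>i<n. norm (f (t (Suc i)) - f (t i)))"
      and t: "t 0 = 0" "t n = 1" "\<And>i. i < n \<Longrightarrow> t i \<le> t (Suc i)"
    unfolding inscribed_lengths_def by blast
  \<comment> \<open>Only successive partition points are compared, so membership in the unit
    interval takes an induction upward from \<open>t 0\<close> and one downward from
    \<open>t n\<close>.\<close>
  have lo: "0 \<le> t i" if "i \<le> n" for i
    using that
  proof (induction i)
    case (Suc i)
    then show ?case using t(3)[of i] by simp
  qed (simp add: t)
  have hi: "t i \<le> 1" if "i \<le> n" for i
    using that
  proof (induction rule: inc_induct)
    case (step i)
    then show ?case using t(3)[of i] by simp
  qed (simp add: t)
  have "v \<le> (\<Sum>i<n. L * (t (Suc i) - t i))"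
    unfolding v
  proof (rule sum_mono)
    fix i assume "i \<in> {..<n}"
    then show "norm (f (t (Suc i)) - f (t i)) \<le> L * (t (Suc i) - t i)"
      using lipschitz_onD[OF assms, of "t (Suc i)" "t i"] lo[of i] hi[of i] lo[of "Suc i"] hi[of "Suc i"] t(3)[of i]
      by (simp add: dist_norm)
  qed
  also have "\<dots> = L" using t by (simp add: sum_lessThan_telescope flip: sum_distrib_left)
  finally show "v \<le> L" .
qed

lemma lipschitz_joined_imp_rectifiable:
  assumes "lipschitz_joined A a b"
  shows "\<exists>\<gamma>. rectifiable_curve_in A a b \<gamma>"
  using assms lipschitz_imp_bdd_above_inscribed_lengths lipschitz_on_continuous_on
  unfolding lipschitz_joined_def rectifiable_curve_in_def path_def path_image_def pathstart_def pathfinish_def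
  by metis

section \<open>Dyadic construction of a Lipschitz curve\<close>

text \<open>Halving the gauge \<open>P\<close> rather than the distance loses no factor: after \<open>k\<close> dyadic subdivisions
  consecutive points are at distance at most \<open>P a b / 2 ^ k\<close>.\<close>

lemma lipschitz_joined_of_midpoints:
  fixes A :: "'a::banach set" and P :: "'a \<Rightarrow> 'a \<Rightarrow> real"
  assumes "closed A"
    and dist_le: "\<And>a b. dist a b \<le> P a b"
    and mid: "\<And>a b. a \<in> A \<Longrightarrow> b \<in> A \<Longrightarrow> P a b \<le> e \<Longrightarrow> \<exists>m\<in>A. P a m \<le> P a b / 2 \<and> P m b \<le> P a b / 2"
    and ab: "a \<in> A" "b \<in> A" "P a b \<le> e"
  shows "lipschitz_joined A a b"
proof -
  define L where "L = P a b"
  have L: "0 \<le> L" "L \<le> e" using dist_le[of a b] ab by (auto simp: L_def intro: order_trans[OF zero_le_dist])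
  obtain M where M: "\<And>a b. a \<in> A \<Longrightarrow> b \<in> A \<Longrightarrow> P a b \<le> e
      \<Longrightarrow> M a b \<in> A \<and> P a (M a b) \<le> P a b / 2 \<and> P (M a b) b \<le> P a b / 2"
    using mid by metis
  \<comment> \<open>\<open>F k i\<close> is vertex \<open>i\<close> of the polygon at level
    \<open>k\<close>: even indices copy the previous level, odd ones insert \<open>M\<close> of two
    neighbours. Only indices up to \<open>2 ^ k\<close> matter.\<close>
  define F where "F = rec_nat (\<lambda>i::nat. if i = 0 then a else b)
    (\<lambda>k G i. if even i then G (i div 2) else M (G (i div 2)) (G (Suc (i div 2))))"
  have F0: "F 0 i = (if i = 0 then a else b)" for i by (simp add: F_def)
  have F_even: "F (Suc k) (2 * j) = F k j" for k j by (simp add: F_def)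
  have F_odd: "F (Suc k) (Suc (2 * j)) = M (F k j) (F k (Suc j))" for k j by (simp add: F_def)
  have inv: "(\<forall>i\<le>2 ^ k. F k i \<in> A) \<and> (\<forall>i<2 ^ k. P (F k i) (F k (Suc i)) \<le> L / 2 ^ k)" for k
  proof (induction k)
    case 0
    then show ?case using ab by (auto simp: F0 L_def)
  next
    case (Suc k)
    have M': "M (F k j) (F k (Suc j)) \<in> A"
      "P (F k j) (M (F k j) (F k (Suc j))) \<le> L / 2 ^ Suc k"
      "P (M (F k j) (F k (Suc j))) (F k (Suc j)) \<le> L / 2 ^ Suc k" if "j < 2 ^ k" for j
    proof -
      have "L / 2 ^ k \<le> L / 1" using L(1) by (intro divide_left_mono) auto
      then have "P (F k j) (F k (Suc j)) \<le> e" using Suc that L(2) by fastforce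
      then show "M (F k j) (F k (Suc j)) \<in> A"
        "P (F k j) (M (F k j) (F k (Suc j))) \<le> L / 2 ^ Suc k"
        "P (M (F k j) (F k (Suc j))) (F k (Suc j)) \<le> L / 2 ^ Suc k"
        using M[of "F k j" "F k (Suc j)"] Suc that by fastforce+
    qed
    have "F (Suc k) i \<in> A" if "i \<le> 2 ^ Suc k" for i
    proof (cases "even i")
      case True
      then show ?thesis using that Suc by (auto elim!: evenE simp: F_even)
    next
      case False
      then show ?thesis using that M'(1) by (auto elim!: oddE simp: F_odd)
    qed
    moreover have "P (F (Suc k) i) (F (Suc k) (Suc i)) \<le> L / 2 ^ Suc k" if "i < 2 ^ Suc k" for i
    proof (cases "even i")
      case True
      then obtain j where "i = 2 * j" by (elim evenE)
      then show ?thesis using that M'(2)[of j] by (simp add: F_even F_odd)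
    next
      case False
      then obtain j where "i = Suc (2 * j)" by (elim oddE) simp
      then show ?thesis using that M'(3)[of j] F_even[of k "Suc j"] by (simp add: F_odd)
    qed
    ultimately show ?case by blast
  qed
  have F_start: "F k 0 = a" for k
    by (induction k) (use F_even[of _ 0] in \<open>simp_all add: F0\<close>)
  have F_end: "F k (2 ^ k) = b" for k
    by (induction k) (simp_all add: F0 F_even)
  have F_dist: "dist (F k i) (F k j) \<le> L / 2 ^ k * (real j - real i)" if "i \<le> j" "j \<le> 2 ^ k" for k i j
    using that
  proof (induction j rule: dec_induct)
    case (step j)
    have "dist (F k j) (F k (Suc j)) \<le> L / 2 ^ k"
      using inv[of k] step.prems dist_le[of "F k j" "F k (Suc j)"] by (meson Suc_le_lessD order_trans)
    then show ?case
      using step dist_triangle[of "F k i" "F k (Suc j)" "F k j"]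
      by (simp add: algebra_simps add_divide_distrib diff_divide_distrib)
  qed simp
  \<comment> \<open>\<open>g k\<close> is the step function whose value at \<open>t\<close> is the
    level \<open>k\<close> vertex with the dyadic parameter just below \<open>t\<close>; the curve
    is its limit in \<open>k\<close>.\<close>
  define n where "n k t = nat \<lfloor>2 ^ k * t\<rfloor>" for k :: nat and t :: real
  define g where "g k t = F k (n k t)" for k t
  have n_le: "n k t \<le> 2 ^ k" if "t \<in> {0..1}" for k t
  proof -
    have "2 ^ k * t \<le> 2 ^ k * 1" using that by (intro mult_left_mono) auto
    then have "\<lfloor>2 ^ k * t\<rfloor> \<le> \<lfloor>2 ^ k :: real\<rfloor>" by (intro floor_mono) simp
    then show ?thesis by (simp add: n_def nat_le_iff)
  qed
  have n_Suc: "n k t = n (Suc k) t div 2" for k t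
  proof -
    have "\<lfloor>2 ^ k * t\<rfloor> = \<lfloor>2 ^ Suc k * t\<rfloor> div 2"
      using floor_divide_real_eq_div[of 2 "2 ^ Suc k * t"] by simp
    then show ?thesis by (simp add: n_def nat_div_distrib')
  qed
  \<comment> \<open>Refining a level moves the value at \<open>t\<close> either not at all or by a
    single edge, whence a summable bound.\<close>
  have g_step: "norm (g (Suc k) t - g k t) \<le> L / 2 * (1 / 2) ^ k" if t: "t \<in> {0..1}" for k t
  proof (cases "even (n (Suc k) t)")
    case True
    then have "g (Suc k) t = g k t"
      using F_even[of k "n k t"] n_Suc[of k t] by (simp add: g_def)
    then show ?thesis using L by simp
  next
    case False
    then have i: "n (Suc k) t = Suc (2 * n k t)" using n_Suc[of k t] by presburger
    have "dist (F (Suc k) (2 * n k t)) (F (Suc k) (Suc (2 * n k t))) \<le> L / 2 ^ Suc k * 1"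
      using F_dist[of "2 * n k t" "Suc (2 * n k t)" "Suc k"] n_le[OF t, of "Suc k"] i by simp
    then show ?thesis
      using i by (simp add: g_def F_even dist_norm norm_minus_commute power_one_over)
  qed
  define f where "f t = lim (\<lambda>k. g k t)" for t
  have lim: "(\<lambda>k. g k t) \<longlonglongrightarrow> f t" if t: "t \<in> {0..1}" for t
  proof -
    have "summable (\<lambda>k. g (Suc k) t - g k t)"
    proof (rule summable_comparison_test')
      show "summable (\<lambda>k. L / 2 * (1 / 2 :: real) ^ k)"
        by (intro summable_mult) (simp add: summable_geometric)
      show "norm (g (Suc k) t - g k t) \<le> L / 2 * (1 / 2) ^ k" if "0 \<le> k" for k
        by (rule g_step[OF t])
    qed
    then have "convergent (\<lambda>k. g k t - g 0 t)"
      by (simp add: summable_iff_convergent sum_lessThan_telescope[of "\<lambda>k. g k t"])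
    then have "convergent (\<lambda>k. g k t)"
      using convergent_diff_const_right_iff by blast
    then show ?thesis unfolding f_def by (simp add: convergent_LIMSEQ_iff)
  qed
  have "L-lipschitz_on {0..1} f"
  proof (rule lipschitz_on_leI)
    fix t u :: real assume tu: "t \<in> {0..1}" "u \<in> {0..1}" "t \<le> u"
    \<comment> \<open>Rounding can add one edge of length at most \<open>L / 2 ^ k\<close>, an error
      that vanishes in the limit.\<close>
    have bound: "dist (g k t) (g k u) \<le> L * (u - t) + L * (1 / 2) ^ k" for k
    proof -
      have "n k t \<le> n k u"
        using tu by (auto simp: n_def intro!: nat_mono floor_mono)
      then have "dist (g k t) (g k u) \<le> L / 2 ^ k * (real (n k u) - real (n k t))"
        using F_dist n_le[OF tu(2)] by (simp add: g_def)
      also have "\<dots> \<le> L / 2 ^ k * (2 ^ k * u - 2 ^ k * t + 1)"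
      proof (intro mult_left_mono)
        have "0 \<le> 2 ^ k * t" "0 \<le> 2 ^ k * u" using tu by auto
        then have "real (n k u) = of_int \<lfloor>2 ^ k * u\<rfloor>" "real (n k t) = of_int \<lfloor>2 ^ k * t\<rfloor>"
          by (simp_all add: n_def)
        then show "real (n k u) - real (n k t) \<le> 2 ^ k * u - 2 ^ k * t + 1"
          by linarith
      qed (use L in simp)
      also have "\<dots> = L * (u - t) + L * (1 / 2) ^ k"
        by (simp add: field_simps)
      finally show ?thesis .
    qed
    have "dist (f t) (f u) \<le> L * (u - t) + L * 0"
    proof (rule LIMSEQ_le)
      show "(\<lambda>k. dist (g k t) (g k u)) \<longlonglongrightarrow> dist (f t) (f u)"
        by (intro tendsto_intros lim tu)
      show "(\<lambda>k. L * (u - t) + L * (1 / 2) ^ k) \<longlonglongrightarrow> L * (u - t) + L * 0"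
        by (intro tendsto_intros) auto
    qed (use bound in blast)
    then show "dist (f t) (f u) \<le> L * dist t u" using tu by (simp add: dist_real_def)
  qed (rule L(1))
  moreover have "f ` {0..1} \<subseteq> A"
  proof (intro image_subsetI)
    fix t :: real assume t: "t \<in> {0..1}"
    have "g k t \<in> A" for k using inv[of k] n_le[OF t] by (simp add: g_def)
    then show "f t \<in> A" using closed_sequentially[OF \<open>closed A\<close> _ lim[OF t]] by blast
  qed
  moreover have "f 0 = a" by (simp add: f_def g_def n_def F_start)
  moreover have "f 1 = b"
  proof -
    have "n k 1 = 2 ^ k" for k by (simp add: n_def nat_power_eq)
    then show ?thesis by (simp add: f_def g_def F_end)
  qed
  ultimately show ?thesis unfolding lipschitz_joined_def by blast
qed

text \<open>The correction \<open>c * l powr (1 + q)\<close> absorbs the excess over \<open>l / 2\<close> at every step, which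
  replaces the estimate of an infinite product of growth factors.\<close>

lemma halving_gaugeE:
  fixes K q :: real
  assumes K: "0 \<le> K" and q: "0 < q"
  obtains c h where "0 \<le> c" "0 < h"
    "\<And>l m. 0 \<le> l \<Longrightarrow> l \<le> h \<Longrightarrow> 0 \<le> m \<Longrightarrow> m \<le> l / 2 + K * (l * l powr q)
      \<Longrightarrow> m + c * (m * m powr q) \<le> (l + c * (l * l powr q)) / 2"
proof -
  \<comment> \<open>\<open>p\<close> bounds the factor by which the \<open>q\<close>-th power
    shrinks once \<open>m \<le> 3 / 4 * l\<close> is known.\<close>
  define p where "p = (3 / 4 :: real) powr q"
  have p: "0 < p" "p < 1" using powr_less_mono2[of q "3 / 4" 1] q by (auto simp: p_def)
  \<comment> \<open>Half of the surplus \<open>c * (1 - p)\<close> pays for \<open>2 * K\<close>;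
    the smallness of \<open>x\<^sub>0\<close> lets the other half pay for the cross term. The
    \<open>1\<close> added to \<open>K\<close> guards against \<open>K = 0\<close>.\<close>
  define c where "c = 4 * K / (1 - p)"
  define x\<^sub>0 where "x\<^sub>0 = (1 - p) / 4 / (K + 1)"
  define h where "h = x\<^sub>0 powr (1 / q)"
  have c: "0 \<le> c" "2 * K = c * (1 - p) / 2" using K p by (auto simp: c_def)
  have x0: "0 < x\<^sub>0" using K p by (simp add: x\<^sub>0_def)
  have "K * x\<^sub>0 \<le> (K + 1) * x\<^sub>0" using x0 by simp
  also have "\<dots> = (1 - p) / 4"
    using K nonzero_mult_div_cancel_left[of "K + 1" "(1 - p) / 4"] by (simp only: x\<^sub>0_def times_divide_eq_right)
  finally have Kx0: "K * x\<^sub>0 \<le> (1 - p) / 4" .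
  have "m + c * (m * m powr q) \<le> (l + c * (l * l powr q)) / 2"
    if l: "0 \<le> l" "l \<le> h" and m: "0 \<le> m" "m \<le> l / 2 + K * (l * l powr q)" for l m
  proof -
    define x where "x = l powr q"
    have x: "0 \<le> x" by (simp add: x_def)
    have "x \<le> h powr q" unfolding x_def using l q by (intro powr_mono2) auto
    also have "\<dots> = x\<^sub>0" using q x0 by (simp add: h_def powr_powr)
    finally have "K * x \<le> K * x\<^sub>0" using K by (intro mult_left_mono)
    with Kx0 have Kx: "4 * (K * x) \<le> 1 - p" by simp
    have m': "m \<le> l / 2 * (1 + 2 * (K * x))" using m by (simp add: x_def algebra_simps)
    also have "\<dots> \<le> l / 2 * (3 / 2)" using l Kx p by (intro mult_left_mono) auto
    finally have "m powr q \<le> (3 / 4 * l) powr q" using m q by (intro powr_mono2) auto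
    also have "\<dots> = p * x" using powr_mult[of "3 / 4" l q] l by (simp add: p_def x_def)
    finally have mq: "m powr q \<le> p * x" .
    have "(K * x) * (2 * (c * p)) \<le> (1 - p) / 4 * (2 * (c * p))"
      using Kx c p by (intro mult_right_mono) auto
    also have "\<dots> \<le> (1 - p) / 4 * (2 * (c * 1))"
      using c p by (intro mult_left_mono) auto
    finally have "2 * K + c * p + 2 * K * (c * p * x) \<le> c"
      using c(2) by (simp add: algebra_simps)
    then have "x * (2 * K + c * p + 2 * K * (c * p * x)) \<le> x * c"
      using x by (intro mult_left_mono)
    then have fin: "(1 + 2 * (K * x)) * (1 + c * (p * x)) \<le> 1 + c * x"
      by (simp add: algebra_simps)
    have "m + c * (m * m powr q) = m * (1 + c * m powr q)" by (simp add: algebra_simps)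
    also have "\<dots> \<le> m * (1 + c * (p * x))"
      using m c mq by (intro mult_left_mono add_left_mono) auto
    also have "\<dots> \<le> l / 2 * (1 + 2 * (K * x)) * (1 + c * (p * x))"
      using m' c p x by (intro mult_right_mono) auto
    also have "\<dots> \<le> l / 2 * (1 + c * x)"
      using mult_left_mono[OF fin, of "l / 2"] l by (simp add: mult.assoc)
    finally show ?thesis by (simp add: x_def algebra_simps)
  qed
  moreover have "0 < h" using x0 by (simp add: h_def)
  ultimately show ?thesis using c(1) by (intro that)
qed

section \<open>Projections onto sets with a smooth distance function\<close>

locale smooth_distance =
  fixes A :: "'a::banach set" and R :: real and D :: "'a \<Rightarrow> 'a \<Rightarrow>\<^sub>L real"
  assumes uc: "uniformly_convex TYPE('a)"
    and closed: "closed A" and nonempty: "A \<noteq> {}"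
    and deriv: "\<And>x. 0 < infdist x A \<Longrightarrow> infdist x A < R
      \<Longrightarrow> ((\<lambda>x. infdist x A) has_derivative blinfun_apply (D x)) (at x)"
    and cont: "continuous_on {x. 0 < infdist x A \<and> infdist x A < R} D"
begin

text \<open>\<open>ex_nearest\<close> makes this choice meaningful wherever
  \<open>infdist x A < R\<close>, points of \<open>A\<close> included.\<close>

definition proj :: "'a \<Rightarrow> 'a" where
  "proj x = (SOME a. a \<in> A \<and> norm (x - a) = infdist x A)"

lemma derivE:
  assumes "0 < infdist x A" "infdist x A < R" "e > 0"
  obtains d where "d > 0"
    "\<And>h. norm h < d \<Longrightarrow> \<bar>infdist (x + h) A - infdist x A - D x h\<bar> \<le> e * norm h"
proof -
  obtain d where "d > 0" and
    d: "\<And>y. norm (y - x) < d \<Longrightarrow> norm (infdist y A - infdist x A - D x (y - x)) \<le> e * norm (y - x)"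
    using deriv[OF assms(1,2)] \<open>e > 0\<close> unfolding has_derivative_at_alt by metis
  show ?thesis
    using \<open>d > 0\<close> d[of "x + _"] by (intro that[of d]) auto
qed

text \<open>The distance function is 1-Lipschitz.\<close>

lemma deriv_le_norm:
  assumes x: "0 < infdist x A" "infdist x A < R"
  shows "D x u \<le> norm u"
proof (cases "u = 0")
  case False
  show ?thesis
  proof (rule field_le_epsilon)
    fix e :: real assume "e > 0"
    then obtain d where d: "d > 0"
      "\<And>h. norm h < d \<Longrightarrow> \<bar>infdist (x + h) A - infdist x A - D x h\<bar> \<le> e / norm u * norm h"
      using derivE[OF x, of "e / norm u"] False by auto
    define t where "t = d / (2 * norm u)"
    have t: "t > 0" "norm (t *\<^sub>R u) < d" using d(1) False by (auto simp: t_def)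
    have "t * D x u \<le> t * norm u + t * e"
      using d(2)[OF t(2)] infdist_triangle_abs[of "x + t *\<^sub>R u" A x] t(1) False
      by (simp add: blinfun.scaleR_right mult.commute dist_norm)
    then have "t * D x u \<le> t * (norm u + e)" by (simp add: algebra_simps)
    then show "D x u \<le> norm u + e" using t(1) by simp
  qed
qed (simp add: blinfun.zero_right)

text \<open>Moving from \<open>x\<close> a fraction \<open>t\<close> of the way to \<open>a\<close>
  lowers the distance by almost \<open>t * norm (x - a)\<close>, and the derivative must reproduce
  this drop.\<close>

lemma deriv_minimizingE:
  assumes x: "0 < infdist x A" "infdist x A < R" and "e > 0"
  obtains d where "d > 0"
    "\<And>a. a \<in> A \<Longrightarrow> norm (x - a) \<le> infdist x A + d \<Longrightarrow> norm (x - a) - e \<le> D x (x - a)"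
proof -
  define M where "M = infdist x A + 1"
  have M: "M > 0" using x by (simp add: M_def)
  obtain p where p: "p > 0"
    "\<And>h. norm h < p \<Longrightarrow> \<bar>infdist (x + h) A - infdist x A - D x h\<bar> \<le> e / (2 * M) * norm h"
    using derivE[OF x, of "e / (2 * M)"] M \<open>e > 0\<close> by auto
  \<comment> \<open>\<open>t\<close> is fixed first, with \<open>M\<close> bounding
    \<open>norm (x - a)\<close>, so that the move stays within the radius \<open>p\<close>. Only
    then is the slack taken as \<open>t * e / 2\<close>, small relative to \<open>t\<close>.\<close>
  define t where "t = min (1 / 2) (p / (2 * M))"
  have t: "t > 0" "t \<le> 1 / 2" using p M by (auto simp: t_def)
  have "t * M \<le> p / (2 * M) * M" using M by (intro mult_right_mono) (auto simp: t_def)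
  then have tM: "t * M < p" using p M by simp
  have "norm (x - a) - e \<le> D x (x - a)"
    if a: "a \<in> A" "norm (x - a) \<le> infdist x A + min 1 (t * e / 2)" for a
  proof -
    define N where "N = norm (x - a)"
    define h where "h = t *\<^sub>R (a - x)"
    have N: "N \<le> M" "N \<le> infdist x A + t * e / 2" using a by (auto simp: N_def M_def)
    have h: "norm h = t * N" using t by (simp add: h_def N_def norm_minus_commute)
    have tN: "t * N \<le> t * M" using N t by simp
    have "x + h - a = (1 - t) *\<^sub>R (x - a)" by (simp add: h_def algebra_simps)
    then have "infdist (x + h) A \<le> (1 - t) * N"
      using infdist_le[OF a(1), of "x + h"] t by (simp add: dist_norm N_def)
    moreover have "\<bar>infdist (x + h) A - infdist x A - D x h\<bar> \<le> e / (2 * M) * (t * N)"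
      using p(2)[of h] h tN tM by simp
    moreover have "e / (2 * M) * (t * N) \<le> e / (2 * M) * (t * M)"
      using M \<open>e > 0\<close> by (intro mult_left_mono[OF tN]) simp
    moreover have "e / (2 * M) * (t * M) = t * e / 2" using M by simp
    moreover have "D x h = - (t * D x (x - a))"
      by (simp add: h_def blinfun.scaleR_right blinfun.diff_right algebra_simps)
    ultimately have "t * (N - e) \<le> t * D x (x - a)"
      using N(2) by (simp add: algebra_simps abs_le_iff)
    then show ?thesis using t by (simp add: N_def)
  qed
  moreover have "min 1 (t * e / 2) > 0" using t \<open>e > 0\<close> by simp
  ultimately show ?thesis using that by blast
qed

text \<open>For almost nearest \<open>a\<close> and \<open>b\<close>, \<open>D x\<close> is near
  \<open>r\<close> on \<open>x - a\<close> and \<open>x - b\<close>. As \<open>D x\<close> has norm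
  at most 1, their sum has norm near \<open>2 * r\<close>, and uniform convexity makes minimizing
  sequences Cauchy.\<close>

lemma ex_nearest:
  assumes "infdist x A < R"
  shows "\<exists>a. a \<in> A \<and> norm (x - a) = infdist x A"
proof (cases "infdist x A = 0")
  case True
  then show ?thesis using closed nonempty in_closed_iff_infdist_zero by fastforce
next
  case False
  then have x: "0 < infdist x A" using infdist_nonneg[of x A] by linarith
  define r where "r = infdist x A"
  have "\<exists>a\<in>A. norm (x - a) < r + inverse (real (Suc n))" for n
  proof -
    have "(INF a\<in>A. dist x a) < r + inverse (real (Suc n))"
      by (simp add: r_def infdist_notempty[OF nonempty, symmetric])
    then show ?thesis
      using cInf_lessD[of "dist x ` A"] nonempty by (auto simp: dist_norm)
  qed
  then obtain a where a: "\<And>n. a n \<in> A" "\<And>n. norm (x - a n) < r + inverse (real (Suc n))"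
    by metis
  have "Cauchy a"
  proof (rule CauchyI)
    fix e :: real assume "e > 0"
    then obtain c where c: "c > 0" "\<And>u v::'a. norm u \<le> r + c \<Longrightarrow> norm v \<le> r + c
        \<Longrightarrow> norm (u + v) \<ge> 2 * (r - c) \<Longrightarrow> norm (u - v) < e"
      using uniformly_convex_scaledE[OF uc] x r_def by metis
    obtain d where d: "d > 0"
      "\<And>b. b \<in> A \<Longrightarrow> norm (x - b) \<le> r + d \<Longrightarrow> norm (x - b) - c \<le> D x (x - b)"
      using deriv_minimizingE[OF x assms \<open>c > 0\<close>] r_def by metis
    obtain N where N: "inverse (real (Suc N)) < min c d"
      using reals_Archimedean[of "min c d"] c d by auto
    have near: "norm (x - a n) \<le> r + c" "r - c \<le> D x (x - a n)" if "n \<ge> N" for n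
    proof -
      have "inverse (real (Suc n)) \<le> inverse (real (Suc N))" using that by simp
      then have "norm (x - a n) \<le> r + c" "norm (x - a n) \<le> r + d" using a(2)[of n] N by linarith+
      moreover have "r \<le> norm (x - a n)"
        using infdist_le[OF a(1)] by (simp add: r_def dist_norm)
      ultimately show "norm (x - a n) \<le> r + c" "r - c \<le> D x (x - a n)"
        using d(2)[OF a(1)[of n]] by linarith+
    qed
    have "norm (a m - a n) < e" if "m \<ge> N" "n \<ge> N" for m n
    proof -
      have "2 * (r - c) \<le> D x ((x - a n) + (x - a m))"
        using near[OF that(1)] near[OF that(2)] by (simp add: blinfun.add_right)
      also have "\<dots> \<le> norm ((x - a n) + (x - a m))" using deriv_le_norm[OF x assms] .
      finally have "norm ((x - a n) - (x - a m)) < e"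
        using near[OF that(1)] near[OF that(2)] by (intro c(2))
      then show ?thesis by simp
    qed
    then show "\<exists>M. \<forall>m\<ge>M. \<forall>n\<ge>M. norm (a m - a n) < e" by blast
  qed
  then obtain b where b: "a \<longlonglongrightarrow> b" using Cauchy_convergent convergent_def by blast
  have "b \<in> A" using closed_sequentially[OF closed a(1) b] .
  moreover have "norm (x - b) \<le> r + 0"
  proof (rule LIMSEQ_le)
    show "(\<lambda>n. norm (x - a n)) \<longlonglongrightarrow> norm (x - b)" by (intro tendsto_intros b)
    show "(\<lambda>n. r + inverse (real (Suc n))) \<longlonglongrightarrow> r + 0"
      by (intro tendsto_intros LIMSEQ_inverse_real_of_nat)
    show "\<exists>N. \<forall>n\<ge>N. norm (x - a n) \<le> r + inverse (real (Suc n))"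
      using a(2) less_imp_le by blast
  qed
  ultimately show ?thesis
    using infdist_le[of b A x] by (intro exI[of _ b]) (auto simp: r_def dist_norm)
qed

lemma proj_in: "infdist x A < R \<Longrightarrow> proj x \<in> A"
  and norm_diff_proj: "infdist x A < R \<Longrightarrow> norm (x - proj x) = infdist x A"
  using someI_ex[OF ex_nearest] unfolding proj_def by auto

lemma proj_eq_self: "R > 0 \<Longrightarrow> x \<in> A \<Longrightarrow> proj x = x"
  using norm_diff_proj[of x] by simp

text \<open>A nearest point qualifies in \<open>deriv_minimizingE\<close> for every tolerance; the
  other inequality is the norm bound.\<close>

lemma deriv_proj:
  assumes x: "0 < infdist x A" "infdist x A < R"
  shows "D x (x - proj x) = infdist x A"
proof (rule antisym)
  show "D x (x - proj x) \<le> infdist x A"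
    using deriv_le_norm[OF x] norm_diff_proj[OF x(2)] by metis
  show "infdist x A \<le> D x (x - proj x)"
  proof (rule field_le_epsilon)
    fix e :: real assume "e > 0"
    from deriv_minimizingE[OF x this] show "infdist x A \<le> D x (x - proj x) + e"
      using proj_in[OF x(2)] norm_diff_proj[OF x(2)] by (smt (verit))
  qed
qed

text \<open>Off \<open>A\<close>, continuity of \<open>D\<close> makes \<open>D x\<close> almost
  attain the distance at \<open>y - proj y\<close> too, so uniform convexity brings
  \<open>y - proj y\<close> close to \<open>x - proj x\<close>. At points of \<open>A\<close> the
  triangle inequality suffices.\<close>

lemma continuous_on_proj: "continuous_on {x. infdist x A < R} proj"
  unfolding continuous_on_iff
proof (intro ballI allI impI)
  fix x and e :: real assume "x \<in> {x. infdist x A < R}" and "e > 0"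
  then have xR: "infdist x A < R" by simp
  show "\<exists>d>0. \<forall>y\<in>{x. infdist x A < R}. dist y x < d \<longrightarrow> dist (proj y) (proj x) < e"
  proof (cases "infdist x A = 0")
    case True
    have "dist (proj y) (proj x) < e" if y: "infdist y A < R" "dist y x < e / 2" for y
    proof -
      have "x = proj x" using norm_diff_proj[OF xR] True by simp
      moreover have "norm (y - proj y) \<le> norm (y - x)"
        using norm_diff_proj[OF y(1)] infdist_triangle_abs[of y A x] True by (simp add: dist_norm)
      moreover have "dist (proj y) x \<le> norm (y - proj y) + norm (y - x)"
        using norm_triangle_ineq[of "proj y - y" "y - x"] by (simp add: dist_norm norm_minus_commute)
      ultimately show ?thesis using y(2) by (simp add: dist_norm)
    qed
    with \<open>e > 0\<close> show ?thesis by (intro exI[of _ "e / 2"]) auto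
  next
    case False
    then have x: "0 < infdist x A" using infdist_nonneg[of x A] by linarith
    define r where "r = infdist x A"
    obtain c where c: "c > 0" "\<And>u v::'a. norm u \<le> r + c \<Longrightarrow> norm v \<le> r + c
        \<Longrightarrow> norm (u + v) \<ge> 2 * (r - c) \<Longrightarrow> norm (u - v) < e / 2"
      using uniformly_convex_scaledE[OF uc, of "e / 2" r] \<open>e > 0\<close> x r_def by auto
    have "c / (2 * r) > 0" using c x r_def by simp
    then obtain p where p: "p > 0" "\<And>y. 0 < infdist y A \<Longrightarrow> infdist y A < R \<Longrightarrow> dist y x < p
        \<Longrightarrow> dist (D y) (D x) < c / (2 * r)"
      using cont x xR unfolding continuous_on_iff by (metis (mono_tags, lifting) mem_Collect_eq)
    \<comment> \<open>The bound \<open>r\<close> keeps \<open>y\<close> off \<open>A\<close> with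
      distance below \<open>2 * r\<close>; \<open>p\<close> controls the derivative,
      \<open>c / 2\<close> the change of the distance and \<open>e / 2\<close> the shift from
      \<open>x\<close> to \<open>y\<close>.\<close>
    have "dist (proj y) (proj x) < e"
      if y: "infdist y A < R" "dist y x < Min {p, c / 2, e / 2, r}" for y
    proof -
      have yx: "\<bar>infdist y A - r\<bar> \<le> dist y x"
        using infdist_triangle_abs[of y A x] by (simp add: r_def dist_norm)
      have y0: "0 < infdist y A" and yr: "r - c / 2 \<le> infdist y A" "infdist y A \<le> r + c / 2"
        using yx y(2) by (auto simp: abs_le_iff)
      have "(D y - D x) (y - proj y) \<le> norm (D y - D x) * norm (y - proj y)"
        using norm_blinfun[of "D y - D x" "y - proj y"] by simp
      also have "\<dots> \<le> c / (2 * r) * (2 * r)"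
        using p(2)[OF y0 y(1)] y(2) yx c x norm_diff_proj[OF y(1)]
        by (intro mult_mono) (auto simp: dist_norm r_def)
      finally have "infdist y A - c \<le> D x (y - proj y)"
        using deriv_proj[OF y0 y(1)] x by (simp add: blinfun.diff_left r_def)
      then have "2 * (r - c) \<le> D x ((x - proj x) + (y - proj y))"
        using deriv_proj[OF x xR] yr c(1) by (simp add: blinfun.add_right r_def)
      also have "\<dots> \<le> norm ((x - proj x) + (y - proj y))" using deriv_le_norm[OF x xR] .
      finally have "norm ((x - proj x) - (y - proj y)) < e / 2"
        using c(1) yr norm_diff_proj[OF y(1)] norm_diff_proj[OF xR]
        by (intro c(2)) (auto simp: r_def)
      moreover have "dist (proj y) (proj x) \<le> norm ((x - proj x) - (y - proj y)) + norm (y - x)"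
        using norm_triangle_ineq[of "(x - proj x) - (y - proj y)" "y - x"] by (simp add: dist_norm)
      ultimately show ?thesis using y(2) by (simp add: dist_norm)
    qed
    moreover have "Min {p, c / 2, e / 2, r} > 0"
      using p c \<open>e > 0\<close> x r_def by simp
    ultimately show ?thesis by (intro exI[of _ "Min {p, c / 2, e / 2, r}"]) auto
  qed
qed

section \<open>Growth of the distance function and nearly exact midpoints\<close>

text \<open>An Ekeland point of \<open>cball z s\<close> must lie on the sphere: at an interior one,
  moving away from its projection raises the distance at rate \<open>1\<close>, faster than the
  slope \<open>1 - e\<close>.\<close>

lemma ex_infdist_increasing:
  assumes z: "0 < infdist z A" "infdist z A + s < R" and s: "s > 0" and e: "0 < e" "e < 1"
  obtains y where "norm (y - z) = s" "infdist z A + (1 - e) * s \<le> infdist y A"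
proof -
  have upper: "infdist y A \<le> infdist z A + dist z y" for y
    using infdist_triangle[of y A z] by (simp add: dist_commute)
  obtain y where y: "y \<in> cball z s" "(1 - e) * dist z y \<le> infdist y A - infdist z A"
    "\<And>w. w \<in> cball z s \<Longrightarrow> (1 - e) * dist y w \<le> infdist w A - infdist y A \<Longrightarrow> w = y"
  proof (rule ekeland_maximal)
    show "complete (cball z s)" by (simp add: complete_eq_closed)
    show "continuous_on (cball z s) (\<lambda>x. infdist x A)" by (intro continuous_intros)
    show "bdd_above ((\<lambda>x. infdist x A) ` cball z s)"
    proof (rule bdd_aboveI2)
      fix y assume "y \<in> cball z s"
      then show "infdist y A \<le> infdist z A + s" using upper[of y] by simp
    qed
    show "1 - e > 0" "z \<in> cball z s" using e s by auto
  qed (rule that)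
  have "dist z y = s"
  proof (rule ccontr)
    assume "dist z y \<noteq> s"
    then have zy: "dist z y < s" using y(1) by simp
    have "0 \<le> (1 - e) * dist z y" using e by simp
    then have yU: "0 < infdist y A" "infdist y A < R"
      using y(2) upper[of y] zy z by linarith+
    define u where "u = (y - proj y) /\<^sub>R infdist y A"
    have u: "norm u = 1" "D y u = 1"
      using norm_diff_proj[OF yU(2)] deriv_proj[OF yU] yU
      by (simp_all add: u_def blinfun.scaleR_right)
    obtain d where d: "d > 0"
      "\<And>h. norm h < d \<Longrightarrow> \<bar>infdist (y + h) A - infdist y A - D y h\<bar> \<le> e * norm h"
      using derivE[OF yU e(1)] by metis
    define t where "t = min (d / 2) (s - dist z y)"
    have t: "t > 0" "t < d" "t \<le> s - dist z y" using d zy by (auto simp: t_def)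
    have "dist z (y + t *\<^sub>R u) \<le> s"
      using dist_triangle[of z "y + t *\<^sub>R u" y] t u by (simp add: dist_norm)
    moreover have "(1 - e) * dist y (y + t *\<^sub>R u) \<le> infdist (y + t *\<^sub>R u) A - infdist y A"
      using d(2)[of "t *\<^sub>R u"] t u by (simp add: dist_norm blinfun.scaleR_right algebra_simps)
    ultimately have "y + t *\<^sub>R u = y" by (intro y(3)) auto
    then show False using t u by auto
  qed
  with y(2) show ?thesis by (intro that[of y]) (auto simp: dist_norm norm_minus_commute)
qed

text \<open>Take \<open>y\<close> at distance \<open>s\<close> from the midpoint with
  \<open>infdist\<close> larger by almost \<open>s\<close>. Both \<open>a\<close> and
  \<open>b\<close> are at least \<open>infdist y A\<close> away from \<open>y\<close>, while
  smoothness bounds the average of these two distances from above.\<close>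

lemma infdist_midpoint_le:
  assumes "a \<in> A" "b \<in> A" and s: "s > 0"
    and z: "0 < infdist (midpoint a b) A" "infdist (midpoint a b) A + s < R"
  shows "infdist (midpoint a b) A \<le> s * smoothness_modulus TYPE('a) (norm (a - b) / (2 * s))"
proof (rule ccontr)
  define m where "m = midpoint a b"
  define h where "h = (1 / 2) *\<^sub>R (a - b)"
  define g where "g = infdist m A - s * smoothness_modulus TYPE('a) (norm (a - b) / (2 * s))"
  assume "\<not> ?thesis"
  then have g: "g > 0" by (simp add: g_def m_def)
  \<comment> \<open>The loss \<open>e * s\<close> is kept at most \<open>g / 2\<close>, while the
    estimate below yields \<open>g \<le> e * s\<close>.\<close>
  define e where "e = min (1 / 2) (g / (2 * s))"
  have e: "0 < e" "e < 1" "e * s \<le> g / 2" using g s by (auto simp: e_def min_def field_simps)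
  obtain y where y: "norm (y - m) = s" "infdist m A + (1 - e) * s \<le> infdist y A"
    using ex_infdist_increasing[OF z s e(1,2)] unfolding m_def by blast
  have mh: "a = m + h" "b = m - h"
    by (simp_all add: m_def h_def midpoint_def algebra_simps flip: scaleR_add_left)
  have "infdist y A \<le> norm (y - m - h)" "infdist y A \<le> norm (y - m + h)"
    using infdist_le[OF assms(1), of y] infdist_le[OF assms(2), of y]
    by (simp_all add: mh dist_norm algebra_simps)
  then have "2 * infdist y A \<le> norm (y - m + h) + norm (y - m - h)" by simp
  also have "\<dots> \<le> 2 * norm (y - m) * (1 + smoothness_modulus TYPE('a) (norm h / norm (y - m)))"
    using y(1) s by (intro smoothness_modulus_upper) auto
  also have "norm h / norm (y - m) = norm (a - b) / (2 * s)"
    using y(1) by (simp add: h_def)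
  finally have "g \<le> e * s"
    using y by (simp add: g_def algebra_simps)
  with e(3) g show False by simp
qed

text \<open>The witness is the projection of the midpoint, whose displacement is bounded by
  smoothness at scale \<open>R / 2\<close>; \<open>norm (a - b) \<le> R / 2\<close> leaves room for
  that scale in the tube. With smoothness exponent \<open>s\<close>, \<open>q\<close> is
  \<open>s - 1\<close>.\<close>

lemma ex_near_midpointE:
  assumes "R > 0" "smoothness_of_power_type TYPE('a)"
  obtains K q where "0 \<le> K" "0 < q"
    "\<And>a b. a \<in> A \<Longrightarrow> b \<in> A \<Longrightarrow> norm (a - b) \<le> R / 2 \<Longrightarrow> \<exists>m\<in>A.
      norm (a - m) \<le> norm (a - b) / 2 + K * (norm (a - b) * norm (a - b) powr q) \<and>
      norm (m - b) \<le> norm (a - b) / 2 + K * (norm (a - b) * norm (a - b) powr q)"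
proof -
  obtain s C where s: "1 < s" and C: "\<And>\<tau>. \<tau> \<ge> 0 \<Longrightarrow> smoothness_modulus TYPE('a) \<tau> \<le> C * \<tau> powr s"
    using assms(2) unfolding smoothness_of_power_type_def by blast
  \<comment> \<open>This collects the constants of \<open>R / 2 * (C * (l / R) powr s)\<close>; the
    absolute value makes \<open>K\<close> nonnegative, as \<open>C\<close> has no prescribed
    sign.\<close>
  define K where "K = R / 2 * \<bar>C\<bar> / R powr s"
  have "\<exists>m\<in>A. norm (a - m) \<le> norm (a - b) / 2 + K * (norm (a - b) * norm (a - b) powr (s - 1)) \<and>
      norm (m - b) \<le> norm (a - b) / 2 + K * (norm (a - b) * norm (a - b) powr (s - 1))"
    if ab: "a \<in> A" "b \<in> A" "norm (a - b) \<le> R / 2" for a b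
  proof -
    define l where "l = norm (a - b)"
    define z where "z = midpoint a b"
    have l: "0 \<le> l" by (simp add: l_def)
    have lq: "l powr s = l * l powr (s - 1)"
      using powr_mult_base[OF l, of "s - 1"] by simp
    have az: "norm (a - z) = l / 2" "norm (z - b) = l / 2"
      using dist_midpoint(1,4)[of a b] by (simp_all add: z_def l_def dist_norm)
    have "infdist z A \<le> l / 2"
      using infdist_le[OF ab(1), of z] az by (simp add: dist_norm norm_minus_commute)
    then have zR: "infdist z A + R / 2 < R" using ab(3) \<open>R > 0\<close> by (simp add: l_def)
    then have zR': "infdist z A < R" using \<open>R > 0\<close> by simp
    have "infdist z A \<le> K * l powr s"
    proof (cases "infdist z A = 0")
      case True
      then show ?thesis using \<open>R > 0\<close> by (simp add: K_def)
    next
      case False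
      then have "0 < infdist z A" using infdist_nonneg[of z A] by linarith
      then have "infdist z A \<le> R / 2 * smoothness_modulus TYPE('a) (l / (2 * (R / 2)))"
        using infdist_midpoint_le[OF ab(1,2), of "R / 2"] zR \<open>R > 0\<close> by (simp add: z_def l_def)
      also have "\<dots> \<le> R / 2 * (C * (l / R) powr s)"
        using C[of "l / R"] l \<open>R > 0\<close> by (intro mult_left_mono) auto
      also have "\<dots> \<le> R / 2 * (\<bar>C\<bar> * (l / R) powr s)"
        using \<open>R > 0\<close> by (intro mult_left_mono mult_right_mono) auto
      also have "\<dots> = K * l powr s"
        using l \<open>R > 0\<close> by (simp add: K_def powr_divide)
      finally show ?thesis .
    qed
    then have "norm (z - proj z) \<le> K * (l * l powr (s - 1))"
      using norm_diff_proj[OF zR'] lq by simp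
    then have "norm (a - proj z) \<le> l / 2 + K * (l * l powr (s - 1))"
      "norm (proj z - b) \<le> l / 2 + K * (l * l powr (s - 1))"
      using norm_triangle_ineq[of "a - z" "z - proj z"] norm_triangle_ineq[of "proj z - z" "z - b"] az
      by (simp_all add: norm_minus_commute)
    then show ?thesis using proj_in[OF zR'] unfolding l_def by blast
  qed
  moreover have "0 \<le> K" using \<open>R > 0\<close> by (simp add: K_def)
  ultimately show ?thesis using s by (intro that[of K "s - 1"]) auto
qed

lemma ex_lipschitz_joined_near:
  assumes "R > 0" "smoothness_of_power_type TYPE('a)"
  shows "\<exists>d>0. \<forall>a\<in>A. \<forall>b\<in>A. dist a b < d \<longrightarrow> lipschitz_joined A a b"
proof -
  obtain K q where K: "0 \<le> K" "0 < q" and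
    mid: "\<And>a b. a \<in> A \<Longrightarrow> b \<in> A \<Longrightarrow> norm (a - b) \<le> R / 2 \<Longrightarrow> \<exists>m\<in>A.
      norm (a - m) \<le> norm (a - b) / 2 + K * (norm (a - b) * norm (a - b) powr q) \<and>
      norm (m - b) \<le> norm (a - b) / 2 + K * (norm (a - b) * norm (a - b) powr q)"
    using ex_near_midpointE[OF assms] by blast
  obtain c h where c: "0 \<le> c" and h: "0 < h" and
    half: "\<And>l m. 0 \<le> l \<Longrightarrow> l \<le> h \<Longrightarrow> 0 \<le> m \<Longrightarrow> m \<le> l / 2 + K * (l * l powr q)
      \<Longrightarrow> m + c * (m * m powr q) \<le> (l + c * (l * l powr q)) / 2"
    using halving_gaugeE[OF K] by blast
  \<comment> \<open>Unlike the norm, this gauge is at least halved when passing to a near-midpoint,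
    by the choice of \<open>c\<close>.\<close>
  define P where "P a b = norm (a - b) + c * (norm (a - b) * norm (a - b) powr q)" for a b :: 'a
  define e where "e = min h (R / 2)"
  have e: "0 < e" using h \<open>R > 0\<close> by (simp add: e_def)
  have dist_le: "dist a b \<le> P a b" for a b using c by (simp add: P_def dist_norm)
  have joined: "lipschitz_joined A a b" if "a \<in> A" "b \<in> A" "P a b \<le> e" for a b
  proof (rule lipschitz_joined_of_midpoints[OF closed dist_le _ that])
    fix a b assume ab: "a \<in> A" "b \<in> A" "P a b \<le> e"
    have small: "norm (a - b) \<le> h" "norm (a - b) \<le> R / 2"
      using ab(3) dist_le[of a b] by (auto simp: e_def dist_norm)
    obtain m where m: "m \<in> A"
      "norm (a - m) \<le> norm (a - b) / 2 + K * (norm (a - b) * norm (a - b) powr q)"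
      "norm (m - b) \<le> norm (a - b) / 2 + K * (norm (a - b) * norm (a - b) powr q)"
      using mid[OF ab(1,2) small(2)] by blast
    then show "\<exists>m\<in>A. P a m \<le> P a b / 2 \<and> P m b \<le> P a b / 2"
      unfolding P_def using half[OF norm_ge_zero small(1) norm_ge_zero] by blast
  qed
  \<comment> \<open>For \<open>l \<le> d \<le> e\<close> the gauge
    \<open>l * (1 + c * l powr q)\<close> is at most
    \<open>d * (1 + c * e powr q) = e\<close>.\<close>
  define d where "d = e / (1 + c * e powr q)"
  have pos: "0 < 1 + c * e powr q" using c by (intro add_pos_nonneg) auto
  have "P a b \<le> e" if "dist a b < d" for a b
  proof -
    have d: "norm (a - b) \<le> d" using that by (simp add: dist_norm)
    have "d \<le> e / 1" unfolding d_def using e c pos by (intro divide_left_mono) auto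
    then have "norm (a - b) powr q \<le> e powr q" using d K by (intro powr_mono2) auto
    then have "norm (a - b) * (1 + c * norm (a - b) powr q) \<le> d * (1 + c * e powr q)"
      using d c order_trans[OF norm_ge_zero d] by (intro mult_mono add_left_mono mult_left_mono) auto
    also have "\<dots> = e" using pos by (simp add: d_def)
    finally show ?thesis by (simp add: P_def algebra_simps)
  qed
  moreover have "0 < d" using e pos by (simp add: d_def)
  ultimately show ?thesis using joined by blast
qed

end

section \<open>From local to global joining\<close>

theorem corollary1p1:
  fixes A :: "'a::banach set" and x\<^sub>0 x\<^sub>1 :: 'a and R :: real
  assumes "uniformly_convex TYPE('a)"
    and "uniformly_smooth TYPE('a)"
    and "smoothness_of_power_type TYPE('a)"
    and "convexity_of_power_type TYPE('a)"
    and "R > 0"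
    and "proximally_smooth R A"
    and "x\<^sub>0 \<in> A" and "x\<^sub>1 \<in> A"
    and "norm (x\<^sub>0 - x\<^sub>1) / R < 2"
  shows "\<exists>\<gamma>. rectifiable_curve_in A x\<^sub>0 x\<^sub>1 \<gamma>"
proof -
  obtain D :: "'a \<Rightarrow> 'a \<Rightarrow>\<^sub>L real" where
    "\<forall>x\<in>{x. 0 < infdist x A \<and> infdist x A < R}.
       ((\<lambda>x. infdist x A) has_derivative blinfun_apply (D x)) (at x)"
    "continuous_on {x. 0 < infdist x A \<and> infdist x A < R} D"
    using \<open>proximally_smooth R A\<close>
    unfolding proximally_smooth_def continuously_differentiable_on_def by blast
  then interpret smooth_distance A R D
    using assms by unfold_locales (auto simp: proximally_smooth_def)
  obtain d where d: "d > 0" "\<And>a b. a \<in> A \<Longrightarrow> b \<in> A \<Longrightarrow> dist a b < d \<Longrightarrow> lipschitz_joined A a b"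
    using ex_lipschitz_joined_near[OF \<open>R > 0\<close> assms(3)] by blast
  define S where "S = proj ` closed_segment x\<^sub>0 x\<^sub>1"
  \<comment> \<open>The distances to the two endpoints add up to less than \<open>2 * R\<close>, so
    one of them is below \<open>R\<close>.\<close>
  have tube: "infdist z A < R" if "z \<in> closed_segment x\<^sub>0 x\<^sub>1" for z
  proof -
    obtain u where u: "0 \<le> u" "u \<le> 1" "z = (1 - u) *\<^sub>R x\<^sub>0 + u *\<^sub>R x\<^sub>1"
      using \<open>z \<in> closed_segment x\<^sub>0 x\<^sub>1\<close> unfolding in_segment by blast
    have "z - x\<^sub>0 = u *\<^sub>R (x\<^sub>1 - x\<^sub>0)" "z - x\<^sub>1 = (1 - u) *\<^sub>R (x\<^sub>0 - x\<^sub>1)"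
      by (simp_all add: u(3) algebra_simps)
    then have "dist z x\<^sub>0 = u * dist x\<^sub>0 x\<^sub>1" "dist z x\<^sub>1 = (1 - u) * dist x\<^sub>0 x\<^sub>1"
      using u(1,2) by (simp_all add: dist_norm norm_minus_commute)
    then have "dist z x\<^sub>0 + dist z x\<^sub>1 = dist x\<^sub>0 x\<^sub>1" by (simp add: algebra_simps)
    moreover have "dist x\<^sub>0 x\<^sub>1 < 2 * R"
      using assms(5,9) by (simp add: dist_norm field_simps)
    ultimately show ?thesis
      using infdist_le[OF assms(7), of z] infdist_le[OF assms(8), of z] by linarith
  qed
  have SA: "S \<subseteq> A" using proj_in tube by (auto simp: S_def)
  have "lipschitz_joined A x\<^sub>0 x\<^sub>1"
  \<comment> \<open>\<open>S\<close> only links the classes: the joining curves stay in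
    \<open>A\<close> but may leave \<open>S\<close>.\<close>
  proof (rule connected_equivalence_relation[where R = "lipschitz_joined A"])
    show "connected S"
      unfolding S_def using tube
      by (intro connected_continuous_image continuous_on_subset[OF continuous_on_proj]) auto
    show "x\<^sub>0 \<in> S" "x\<^sub>1 \<in> S"
      unfolding S_def using proj_eq_self[OF \<open>R > 0\<close>] assms(7,8) by (metis ends_in_segment imageI)+
    fix a assume "a \<in> S"
    then show "\<exists>T. openin (top_of_set S) T \<and> a \<in> T \<and> (\<forall>x\<in>T. lipschitz_joined A a x)"
      using d(1) SA by (intro exI[of _ "S \<inter> ball a d"]) (auto intro!: d(2))
  qed (blast intro: lipschitz_joined_sym lipschitz_joined_trans)+
  then show ?thesis by (rule lipschitz_joined_imp_rectifiable)
qed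

end
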